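(* Let $X$ be a Tychonoff space and let $I$ be an ideal in $C(X)$. Then $X$ is $I$-pseudocompact if and only if $C_{\psi^I}(X)=C(X)$.
   Context: $C(X)$ is the ring of all real-valued continuous functions on $X$; ideals may be improper. $Z(g)=\{x\in X:g(x)=0\}$ and $\bigcap Z[I]=\bigcap_{g\in I}Z(g)$. A subset $Y\subseteq X$ is bounded if every $f\in C(X)$ is bounded on $Y$. $X$ is $I$-pseudocompact if $X\setminus\bigcap Z[I]$ is a bounded subset of $X$. Define $$C_{\psi^I}(X)=\{f\in C(X): \overline{(X\setminus Z(f))\cap (X\setminus\textstyle\bigcap Z[I])}\text{ is a bounded subset of }X\},$$ where the bar denotes closure in $X$. *)

theory Defs
  imports "HOL-Analysis.Analysis" "HOL-Algebra.Ideal"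
begin

text \<open>
  Real-valued continuous functions on a space \<open>X\<close> are represented by HOL functions that are
  \<^const>\<open>undefined\<close> outside \<^term>\<open>topspace X\<close>, so that equality of representatives is
  equality as functions on \<open>X\<close>.
\<close>

definition cont_funs :: "'a topology \<Rightarrow> ('a \<Rightarrow> real) set" where
  "cont_funs X = {f \<in> extensional (topspace X). continuous_map X euclideanreal f}"

definition cont_ring :: "'a topology \<Rightarrow> ('a \<Rightarrow> real) ring" where
  "cont_ring X = \<lparr>carrier = cont_funs X,
     mult = (\<lambda>f g. \<lambda>x\<in>topspace X. f x * g x),
     one = (\<lambda>x\<in>topspace X. 1),
     zero = (\<lambda>x\<in>topspace X. 0),
     add = (\<lambda>f g. \<lambda>x\<in>topspace X. f x + g x)\<rparr>"

definition zero_set :: "'a topology \<Rightarrow> ('a \<Rightarrow> real) \<Rightarrow> 'a set" where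
  "zero_set X g = {x \<in> topspace X. g x = 0}"

definition bounded_subset :: "'a topology \<Rightarrow> 'a set \<Rightarrow> bool" where
  "bounded_subset X Y \<longleftrightarrow> Y \<subseteq> topspace X \<and> (\<forall>f \<in> cont_funs X. bounded (f ` Y))"

definition ideal_pseudocompact :: "'a topology \<Rightarrow> ('a \<Rightarrow> real) set \<Rightarrow> bool" where
  "ideal_pseudocompact X I \<longleftrightarrow> bounded_subset X (topspace X - (\<Inter>g\<in>I. zero_set X g))"

definition cont_funs_psi :: "'a topology \<Rightarrow> ('a \<Rightarrow> real) set \<Rightarrow> ('a \<Rightarrow> real) set" where
  "cont_funs_psi X I = {f \<in> cont_funs X.
     bounded_subset X (X closure_of
       ((topspace X - zero_set X f) \<inter> (topspace X - (\<Inter>g\<in>I. zero_set X g))))}"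

lemma cont_funs_restrict:
  assumes "continuous_map X euclideanreal f"
  shows "restrict f (topspace X) \<in> cont_funs X"
proof -
  have "continuous_map X euclideanreal (restrict f (topspace X))"
    by (rule continuous_map_eq[OF assms]) simp
  then show ?thesis
    by (simp add: cont_funs_def)
qed

lemma cont_funs_continuous: "f \<in> cont_funs X \<Longrightarrow> continuous_map X euclideanreal f"
  by (simp add: cont_funs_def)

lemma cont_funs_restrict_same: "f \<in> cont_funs X \<Longrightarrow> restrict f (topspace X) = f"
  by (simp add: cont_funs_def extensional_restrict)

lemma cring_cont_ring: "cring (cont_ring X)"
proof (rule cringI)
  show "abelian_group (cont_ring X)"
  proof (rule abelian_groupI)
    fix f assume f: "f \<in> carrier (cont_ring X)"
    then have "restrict (\<lambda>x. - f x) (topspace X) \<in> cont_funs X"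
      by (auto simp: cont_ring_def intro!: cont_funs_restrict continuous_map_minus dest: cont_funs_continuous)
    then show "\<exists>g\<in>carrier (cont_ring X). g \<oplus>\<^bsub>cont_ring X\<^esub> f = \<zero>\<^bsub>cont_ring X\<^esub>"
      by (intro bexI[of _ "restrict (\<lambda>x. - f x) (topspace X)"])
         (auto simp: cont_ring_def fun_eq_iff)
  qed (auto simp: cont_ring_def algebra_simps cont_funs_restrict_same cong: restrict_cong
      intro!: cont_funs_restrict continuous_map_add dest: cont_funs_continuous)
  show "comm_monoid (cont_ring X)"
    by (rule comm_monoidI)
      (auto simp: cont_ring_def algebra_simps cont_funs_restrict_same cong: restrict_cong
        intro!: cont_funs_restrict continuous_map_real_mult dest: cont_funs_continuous)
qed (auto simp: cont_ring_def algebra_simps cong: restrict_cong)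

end

theory Submission
  imports Defs
begin

text \<open>Boundedness in X passes to subsets and, by continuity, to closures. Let A be the
  complement of the common zero set of I. If A is bounded, then so is the closure of its part where
  f is nonzero, for every continuous f. Conversely, the constant function 1 vanishes nowhere, so its
  membership in \<open>cont_funs_psi X I\<close> makes the closure of A bounded, hence A
  itself.\<close>

lemma bounded_subset_mono:
  assumes "bounded_subset X Z" "Y \<subseteq> Z"
  shows "bounded_subset X Y"
  using assms unfolding bounded_subset_def by (meson bounded_subset image_mono subset_trans)

text \<open>A continuous f maps the closure of Y into the closure of f(Y), and the closure of a
  bounded set of reals is bounded.\<close>

lemma bounded_subset_closure_of:
  assumes "bounded_subset X Y"
  shows "bounded_subset X (X closure_of Y)"
proof -
  have "bounded (f ` (X closure_of Y))" if "f \<in> cont_funs X" for f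
  proof -
    have "f ` (X closure_of Y) \<subseteq> closure (f ` Y)"
      using continuous_map_image_closure_subset[OF cont_funs_continuous[OF that]] by simp
    moreover have "bounded (closure (f ` Y))"
      using assms that by (simp add: bounded_subset_def bounded_closure)
    ultimately show ?thesis
      using Elementary_Metric_Spaces.bounded_subset by blast
  qed
  then show ?thesis
    by (simp add: bounded_subset_def closure_of_subset_topspace)
qed

theorem theorem3p5:
  fixes X :: "'a topology" and I :: "('a \<Rightarrow> real) set"
  assumes "completely_regular_space X" and "Hausdorff_space X"
    and "ideal I (cont_ring X)"
  shows "ideal_pseudocompact X I \<longleftrightarrow> cont_funs_psi X I = cont_funs X"
proof
  assume "ideal_pseudocompact X I"
  then have "bounded_subset X (X closure_of
      ((topspace X - zero_set X f) \<inter> (topspace X - (\<Inter>g\<in>I. zero_set X g))))" for f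
    unfolding ideal_pseudocompact_def
    \<comment> \<open>The set under the closure lies in the bounded complement, whatever f
      is.\<close>
    by (intro bounded_subset_closure_of) (auto elim: bounded_subset_mono)
  then show "cont_funs_psi X I = cont_funs X"
    by (simp add: cont_funs_psi_def)
next
  let ?A = "topspace X - (\<Inter>g\<in>I. zero_set X g)"
  \<comment> \<open>The unit of the ring: with empty zero set, it makes the intersection with
    \<open>?A\<close> all of \<open>?A\<close>.\<close>
  let ?u = "\<lambda>x\<in>topspace X. 1 :: real"
  assume "cont_funs_psi X I = cont_funs X"
  moreover have "?u \<in> cont_funs X"
    by (rule cont_funs_restrict) simp
  ultimately have "bounded_subset X (X closure_of ((topspace X - zero_set X ?u) \<inter> ?A))"
    by (auto simp: cont_funs_psi_def)
  moreover have "(topspace X - zero_set X ?u) \<inter> ?A = ?A"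
    by (auto simp: zero_set_def)
  ultimately have "bounded_subset X (X closure_of ?A)"
    by simp
  then show "ideal_pseudocompact X I"
    unfolding ideal_pseudocompact_def
    by (rule bounded_subset_mono) (simp add: closure_of_subset)
qed

end
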